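(* Let $u^0\in V$ be a deterministic initial guess and let $u^{k}$, $k\ge 0$, be the iterates of the randomized successive subspace correction method: at each iteration $k$ an index $i\in\{1,\dots,J\}$ is drawn uniformly (probability $p_i=\frac1J$), independently of all previous draws, and $$u^{k+1}=u^k+R_iQ_i(f-Au^k).$$ Put $e^k=u-u^k$, where $u$ is the solution of $Au=f$. Then the method converges with the expected error decay rate, for all $k\ge 0$, $$E(\|u-u^{k+1}\|_A^2)=\Big(1-\frac{\delta_k}{J}\Big)E(\|u-u^k\|_A^2)=\prod_{\ell=0}^{k}\Big(1-\frac{\delta_\ell}{J}\Big)\|u-u^0\|_A^2,$$ where $$\delta_k=\frac{E\big((B_aAe^k,e^k)_A\big)}{E\big((e^k,e^k)_A\big)}>0 .$$ Moreover, if $\|I-T_i\|_A<1$ for $i=1,\dots,J$, then $\delta_k<J$.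
   Context: $V$ is a Hilbert space with inner product $(\cdot,\cdot)$, $A:V\to V$ is a symmetric positive definite linear operator, $(v,w)_A=(Av,w)$ and $\|v\|_A^2=(v,v)_A$. Given $f\in V$, $u\in V$ denotes the solution of $Au=f$. The space is decomposed as $V=\sum_{i=1}^J V_i$ with subspaces $V_i\subset V$ (the sum need not be direct). For each $i$, the operators $Q_i,P_i:V\to V_i$ and $A_i:V_i\to V_i$ are defined by $(Q_iv,v_i)=(v,v_i)$, $(P_iv,v_i)_A=(v,v_i)_A$ for all $v\in V$, $v_i\in V_i$, and $(A_iw_i,v_i)=(Aw_i,v_i)$ for all $w_i,v_i\in V_i$. $I_i:V_i\to V$ is the natural inclusion. $R_i:V_i\to V_i$ is a given nonsingular linear operator (an approximation of $A_i^{-1}$), and $R_i^t$ is its adjoint with respect to $(\cdot,\cdot)$. Define $T_i=R_iQ_iA=R_iA_iP_i$. The condition $\|I-T_i\|_A<1$ refers to $T_i$ as an operator $V_i\to V_i$, i.e. the operator norm induced by $\|\cdot\|_A$ on $V_i$. Define $\bar R_i=R_i^t+R_i-R_i^tA_iR_i$ and the (parallel subspace correction) operator $B_a=\sum_{i=1}^J I_i\bar R_iQ_i$. $E$ denotes expectation over the random index choices. The quotients $\delta_k$ presuppose $E(\|e^k\|_A^2)\neq0$.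
   Formalization: δ_k>0 is claimed only if ‖I−T_i‖_A<1 for all i (for merely nonsingular R_i it fails: V=ℝ, A=1, J=1, R_1=3 gives δ_0=−3), and δ_k<J only if E‖e^{k+1}‖_A²≠0 (with J=1, R_1=A^{-1} one gets δ_0=J). *)

theory Defs
  imports "HOL-Probability.Probability"
begin

definition spd_operator :: "('a::real_inner \<Rightarrow> 'a) \<Rightarrow> bool" where
  "spd_operator A \<longleftrightarrow>
     linear A \<and> (\<forall>v w. A v \<bullet> w = v \<bullet> A w) \<and> (\<forall>v. v \<noteq> 0 \<longrightarrow> A v \<bullet> v > 0)"

definition A_inner :: "('a::real_inner \<Rightarrow> 'a) \<Rightarrow> 'a \<Rightarrow> 'a \<Rightarrow> real" where
  "A_inner A v w = A v \<bullet> w"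

definition A_norm :: "('a::real_inner \<Rightarrow> 'a) \<Rightarrow> 'a \<Rightarrow> real" where
  "A_norm A v = sqrt (A_inner A v v)"

(* The supremum is taken in ennreal, so it is infinite for an unbounded F; the vector v = 0
   contributes 0 / 0 = 0, so the norm is 0 on the trivial subspace. *)
definition A_opnorm_on :: "('a::real_inner \<Rightarrow> 'a) \<Rightarrow> 'a set \<Rightarrow> ('a \<Rightarrow> 'a) \<Rightarrow> ennreal" where
  "A_opnorm_on A S F = (SUP v\<in>S. ennreal (A_norm A (F v) / A_norm A v))"

definition space_decomposition :: "nat \<Rightarrow> (nat \<Rightarrow> 'a::real_vector set) \<Rightarrow> bool" where
  "space_decomposition J V \<longleftrightarrow>
     (\<forall>i\<in>{1..J}. subspace (V i)) \<and>
     (\<forall>v. \<exists>w. (\<forall>i\<in>{1..J}. w i \<in> V i) \<and> v = (\<Sum>i=1..J. w i))"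

(* Operators V_i -> V_i are total functions on the ambient type that are only constrained on V_i.
   The following predicates are the defining relations of Q_i, P_i, A_i and R_i^t; each of them
   determines its operator uniquely, on V for Q_i and P_i and on V_i for A_i and R_i^t. *)

definition is_projection :: "'a::real_inner set \<Rightarrow> ('a \<Rightarrow> 'a) \<Rightarrow> bool" where
  "is_projection S Q \<longleftrightarrow> (\<forall>v. Q v \<in> S \<and> (\<forall>w\<in>S. Q v \<bullet> w = v \<bullet> w))"

definition is_A_projection :: "('a::real_inner \<Rightarrow> 'a) \<Rightarrow> 'a set \<Rightarrow> ('a \<Rightarrow> 'a) \<Rightarrow> bool" where
  "is_A_projection A S P \<longleftrightarrow>
     (\<forall>v. P v \<in> S \<and> (\<forall>w\<in>S. A_inner A (P v) w = A_inner A v w))"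

definition is_restriction :: "('a::real_inner \<Rightarrow> 'a) \<Rightarrow> 'a set \<Rightarrow> ('a \<Rightarrow> 'a) \<Rightarrow> bool" where
  "is_restriction A S AS \<longleftrightarrow> (\<forall>w\<in>S. AS w \<in> S \<and> (\<forall>v\<in>S. AS w \<bullet> v = A w \<bullet> v))"

definition is_adjoint_on :: "'a::real_inner set \<Rightarrow> ('a \<Rightarrow> 'a) \<Rightarrow> ('a \<Rightarrow> 'a) \<Rightarrow> bool" where
  "is_adjoint_on S R Rt \<longleftrightarrow> (\<forall>w\<in>S. Rt w \<in> S \<and> (\<forall>v\<in>S. Rt w \<bullet> v = w \<bullet> R v))"

definition nonsingular_linear_on :: "'a::real_vector set \<Rightarrow> ('a \<Rightarrow> 'a) \<Rightarrow> bool" where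
  "nonsingular_linear_on S R \<longleftrightarrow>
     (\<forall>v\<in>S. \<forall>w\<in>S. R (v + w) = R v + R w) \<and>
     (\<forall>c. \<forall>v\<in>S. R (c *\<^sub>R v) = c *\<^sub>R R v) \<and>
     bij_betw R S S"

definition R_bar :: "('a::real_vector \<Rightarrow> 'a) \<Rightarrow> ('a \<Rightarrow> 'a) \<Rightarrow> ('a \<Rightarrow> 'a) \<Rightarrow> 'a \<Rightarrow> 'a" where
  "R_bar AS R Rt w = Rt w + R w - Rt (AS (R w))"

(* The inclusions I_i are identities here, since every V_i lives in the ambient type. *)
definition B_parallel ::
  "nat \<Rightarrow> (nat \<Rightarrow> 'a::real_vector \<Rightarrow> 'a) \<Rightarrow> (nat \<Rightarrow> 'a \<Rightarrow> 'a) \<Rightarrow> (nat \<Rightarrow> 'a \<Rightarrow> 'a) \<Rightarrow>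
   (nat \<Rightarrow> 'a \<Rightarrow> 'a) \<Rightarrow> 'a \<Rightarrow> 'a" where
  "B_parallel J Q AS R Rt v = (\<Sum>i=1..J. R_bar (AS i) (R i) (Rt i) (Q i v))"

definition T_op :: "('a \<Rightarrow> 'a) \<Rightarrow> ('a \<Rightarrow> 'a) \<Rightarrow> ('a \<Rightarrow> 'a) \<Rightarrow> 'a \<Rightarrow> 'a" where
  "T_op A Q R v = R (Q (A v))"

end

theory Submission
  imports Defs
begin

text \<open>
  Choosing index i turns the error v into v - T_i v, and by symmetry of A this lowers its squared
  energy norm by exactly (R_bar_i Q_i A v, v)_A. Since the drawn index is independent of the current
  error, averaging over i lowers the expected squared energy norm by E (B_a A e, e)_A / J, which is
  the decay identity. The i-th summand of (B_a A v, v)_A depends on v only through w = P_i v and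
  equals the squared energy norm of w minus that of w - T_i w. A contraction makes this positive
  unless P_i v = 0, and some P_i v is nonzero when v is, because the V_i span V. The bound
  delta_k < J is the positivity of the next expected error in the decay identity.
\<close>

section \<open>Energy inner product of a symmetric positive definite operator\<close>

lemma spd_operatorD:
  assumes "spd_operator A"
  shows "linear A" "A v \<bullet> w = v \<bullet> A w" "v \<noteq> 0 \<Longrightarrow> A v \<bullet> v > 0"
  using assms by (auto simp: spd_operator_def)

lemma A_inner_self_nonneg:
  assumes "spd_operator A"
  shows "A_inner A v v \<ge> 0"
  using spd_operatorD(3)[OF assms, of v] linear_0[OF spd_operatorD(1)[OF assms]]
  by (cases "v = 0") (auto simp: A_inner_def)

lemma A_inner_self_eq_0_iff:
  assumes "spd_operator A"
  shows "A_inner A v v = 0 \<longleftrightarrow> v = 0"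
  using spd_operatorD(3)[OF assms, of v] by (cases "v = 0") (auto simp: A_inner_def)

lemma A_norm_power2:
  assumes "spd_operator A"
  shows "(A_norm A v)\<^sup>2 = A_inner A v v"
  using A_inner_self_nonneg[OF assms] by (simp add: A_norm_def)

lemma A_inner_diff_self:
  assumes "spd_operator A"
  shows "A_inner A (v - w) (v - w) = A_inner A v v - 2 * (A v \<bullet> w) + A_inner A w w"
  using spd_operatorD(1,2)[OF assms]
  by (simp add: A_inner_def linear_diff inner_diff_left inner_diff_right inner_commute)

section \<open>Energy change caused by a correction in one subspace\<close>

lemma R_bar_mem:
  assumes "subspace S" "is_restriction A S AS" "nonsingular_linear_on S R" "is_adjoint_on S R Rt"
    and "g \<in> S"
  shows "R_bar AS R Rt g \<in> S"
proof -
  have "R g \<in> S"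
    using assms by (auto simp: nonsingular_linear_on_def bij_betw_def)
  then show ?thesis
    using assms unfolding R_bar_def is_restriction_def is_adjoint_on_def
    by (simp add: subspace_add subspace_diff)
qed

text \<open>Put \<open>g = Q (A v)\<close>. Since \<open>R g\<close> lies in \<open>S\<close>,
  pairing it with \<open>A v\<close> is pairing it with \<open>g\<close>, and \<open>AS\<close> may
  stand for \<open>A\<close> on it. The adjoint turns \<open>Rt g\<close> into a second copy of
  \<open>g \<bullet> R g\<close>, so the form of \<open>R_bar\<close> at \<open>g\<close> is the
  cross term minus the quadratic term of the expanded square.\<close>

lemma A_inner_T_op_diff:
  assumes A: "spd_operator A" and S: "subspace S" and Q: "is_projection S Q"
    and AS: "is_restriction A S AS" and R: "nonsingular_linear_on S R" and Rt: "is_adjoint_on S R Rt"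
  shows "A_inner A (v - T_op A Q R v) (v - T_op A Q R v)
    = A_inner A v v - A_inner A (R_bar AS R Rt (Q (A v))) v"
proof -
  define g where "g = Q (A v)"
  have gS: "g \<in> S" and Qg: "\<And>w. w \<in> S \<Longrightarrow> g \<bullet> w = A v \<bullet> w"
    using Q by (auto simp: is_projection_def g_def)
  have RgS: "R g \<in> S"
    using R gS by (auto simp: nonsingular_linear_on_def bij_betw_def)
  have "A_inner A (R_bar AS R Rt g) v = g \<bullet> R_bar AS R Rt g"
    using Qg[OF R_bar_mem[OF S AS R Rt gS]] spd_operatorD(2)[OF A]
    by (simp add: A_inner_def inner_commute)
  also have "\<dots> = 2 * (g \<bullet> R g) - AS (R g) \<bullet> R g"
    using Rt AS gS RgS unfolding is_adjoint_on_def is_restriction_def R_bar_def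
    by (simp add: inner_add_right inner_diff_right inner_commute)
  also have "\<dots> = 2 * (A v \<bullet> R g) - A_inner A (R g) (R g)"
    using AS RgS Qg by (simp add: is_restriction_def A_inner_def)
  finally show ?thesis
    using A_inner_diff_self[OF A, of v "R g"] by (simp add: T_op_def g_def)
qed

text \<open>The difference of the two images lies in \<open>S\<close> and is orthogonal to
  \<open>S\<close>, hence to itself. This later identifies \<open>Q (A (P v))\<close> with
  \<open>Q (A v)\<close>.\<close>

lemma is_projection_unique:
  assumes "subspace S" "is_projection S Q" "\<And>w. w \<in> S \<Longrightarrow> x \<bullet> w = y \<bullet> w"
  shows "Q x = Q y"
proof -
  have "Q x - Q y \<in> S"
    using assms by (simp add: is_projection_def subspace_diff)
  then have "(Q x - Q y) \<bullet> (Q x - Q y) = 0"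
    using assms by (simp add: is_projection_def inner_diff_left)
  then show ?thesis by simp
qed

text \<open>The supremum bounds the quotient at \<open>w\<close>, whose denominator is positive by
  definiteness.\<close>

lemma A_inner_less_of_opnorm_less_1:
  assumes A: "spd_operator A" and F: "A_opnorm_on A S F < 1" and "w \<in> S" "w \<noteq> 0"
  shows "A_inner A (F w) (F w) < A_inner A w w"
proof -
  have pos: "A_norm A w > 0"
    using spd_operatorD(3)[OF A \<open>w \<noteq> 0\<close>] by (simp add: A_norm_def A_inner_def)
  have "ennreal (A_norm A (F w) / A_norm A w) < 1"
    using SUP_upper[OF \<open>w \<in> S\<close>, of "\<lambda>v. ennreal (A_norm A (F v) / A_norm A v)"] F
    unfolding A_opnorm_on_def by (rule le_less_trans)
  then have "A_norm A (F w) < A_norm A w"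
    using pos by (simp add: ennreal_less_one_iff)
  then show ?thesis by (simp add: A_norm_def)
qed

text \<open>The contraction speaks only about vectors of \<open>S\<close>, while \<open>v\<close> is
  arbitrary. Both arguments of the form see \<open>v\<close> only through \<open>P v\<close>, so the
  strict decrease of the energy at \<open>P v\<close> carries over to \<open>v\<close>.\<close>

lemma R_bar_form_pos:
  assumes A: "spd_operator A" and S: "subspace S" and Q: "is_projection S Q"
    and P: "is_A_projection A S P" and AS: "is_restriction A S AS"
    and R: "nonsingular_linear_on S R" and Rt: "is_adjoint_on S R Rt"
    and contr: "A_opnorm_on A S (\<lambda>v. v - T_op A Q R v) < 1"
    and "P v \<noteq> 0"
  shows "A_inner A (R_bar AS R Rt (Q (A v))) v > 0"
proof -
  have PvS: "P v \<in> S" and QP: "Q (A (P v)) = Q (A v)"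
    using P is_projection_unique[OF S Q, of "A (P v)" "A v"]
    by (simp_all add: is_A_projection_def A_inner_def)
  have "A_inner A (R_bar AS R Rt (Q (A (P v)))) (P v) > 0"
    using A_inner_less_of_opnorm_less_1[OF A contr PvS \<open>P v \<noteq> 0\<close>]
      A_inner_T_op_diff[OF A S Q AS R Rt, of "P v"] by simp
  \<comment> \<open>Membership in \<open>S\<close> allows \<open>v\<close> to be exchanged for
    \<open>P v\<close> in the second argument of the energy product.\<close>
  moreover have "R_bar AS R Rt (Q (A v)) \<in> S"
    using R_bar_mem[OF S AS R Rt] Q by (simp add: is_projection_def)
  ultimately show ?thesis
    using P spd_operatorD(2)[OF A] unfolding QP is_A_projection_def A_inner_def
    by (metis inner_commute)
qed

text \<open>Complements the positive case: the corrected vector lies in \<open>S\<close>, so its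
  energy product with \<open>v\<close> is the one with \<open>P v\<close>.\<close>

lemma R_bar_form_eq_0:
  assumes A: "spd_operator A" and S: "subspace S" and Q: "is_projection S Q"
    and P: "is_A_projection A S P" and AS: "is_restriction A S AS"
    and R: "nonsingular_linear_on S R" and Rt: "is_adjoint_on S R Rt"
    and "P v = 0"
  shows "A_inner A (R_bar AS R Rt (Q (A v))) v = 0"
proof -
  have "R_bar AS R Rt (Q (A v)) \<in> S"
    using R_bar_mem[OF S AS R Rt] Q by (simp add: is_projection_def)
  then have "A v \<bullet> R_bar AS R Rt (Q (A v)) = A 0 \<bullet> R_bar AS R Rt (Q (A v))"
    using P \<open>P v = 0\<close> unfolding is_A_projection_def A_inner_def by metis
  then show ?thesis
    using linear_0[OF spd_operatorD(1)[OF A]] spd_operatorD(2)[OF A]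
    by (simp add: A_inner_def inner_commute)
qed

text \<open>If every \<open>P i v\<close> vanished, \<open>A v\<close> would be orthogonal to each
  \<open>V i\<close>, hence to their sum and to \<open>v\<close> itself, against
  definiteness.\<close>

lemma A_projections_separate:
  assumes A: "spd_operator A" and V: "space_decomposition J V"
    and P: "\<And>i. i \<in> {1..J} \<Longrightarrow> is_A_projection A (V i) (P i)"
    and "v \<noteq> 0"
  shows "\<exists>i\<in>{1..J}. P i v \<noteq> 0"
proof (rule ccontr)
  assume 0: "\<not> ?thesis"
  obtain w where w: "\<And>i. i \<in> {1..J} \<Longrightarrow> w i \<in> V i" and v: "v = (\<Sum>i=1..J. w i)"
    using V unfolding space_decomposition_def by blast
  have "A v \<bullet> w i = 0" if i: "i \<in> {1..J}" for i
    using P[OF i] w[OF i] 0 i linear_0[OF spd_operatorD(1)[OF A]]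
    unfolding is_A_projection_def A_inner_def by (metis inner_zero_left)
  then have "A v \<bullet> (\<Sum>i=1..J. w i) = 0"
    by (simp add: inner_sum_right)
  then show False
    using spd_operatorD(3)[OF A \<open>v \<noteq> 0\<close>] v by simp
qed

lemma A_inner_B_parallel:
  assumes "spd_operator A"
  shows "A_inner A (B_parallel J Q AS R Rt (A v)) v
    = (\<Sum>i=1..J. A_inner A (R_bar (AS i) (R i) (Rt i) (Q i (A v))) v)"
  using spd_operatorD(1)[OF assms]
  by (simp add: A_inner_def B_parallel_def linear_sum inner_sum_left)

section \<open>Trajectories as functions of the index sequence\<close>

text \<open>
  Errors are written as functions of the drawn indices, all of them discrete, so that measurability
  and independence come from the indices and no measurability of A, Q or R is needed.
\<close>
primrec orbit :: "(nat \<Rightarrow> 'b \<Rightarrow> 'b) \<Rightarrow> 'b \<Rightarrow> nat \<Rightarrow> (nat \<Rightarrow> nat) \<Rightarrow> 'b" where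
  "orbit S x 0 a = x"
| "orbit S x (Suc k) a = S (a k) (orbit S x k a)"

lemma orbit_cong: "(\<And>j. j < k \<Longrightarrow> a j = b j) \<Longrightarrow> orbit S x k a = orbit S x k b"
  by (induction k) auto

text \<open>Indices range over a countable type, so the step may be split by the value of the
  current index. Each branch is a map out of a discrete space and therefore measurable.\<close>

lemma measurable_orbit:
  assumes "\<And>j. j < k \<Longrightarrow> (\<lambda>\<omega>. a \<omega> j) \<in> measurable N (count_space UNIV)"
  shows "(\<lambda>\<omega>. orbit S x k (a \<omega>)) \<in> measurable N (count_space UNIV)"
  using assms
proof (induction k)
  case (Suc k)
  have [measurable]: "(\<lambda>\<omega>. orbit S x k (a \<omega>)) \<in> measurable N (count_space UNIV)"
      "(\<lambda>\<omega>. a \<omega> k) \<in> measurable N (count_space UNIV)"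
    using Suc by auto
  have "(\<lambda>\<omega>. S (a \<omega> k) (orbit S x k (a \<omega>))) \<in> measurable N (count_space UNIV)"
    by (rule measurable_compose_countable[where g = "\<lambda>\<omega>. a \<omega> k"])
      (auto intro: measurable_compose[where N = "count_space UNIV"])
  then show ?case by simp
qed simp

text \<open>Each step has at most \<open>card I\<close> branches. Finiteness replaces any
  boundedness assumption when integrability is shown.\<close>

lemma finite_orbits:
  assumes "finite I"
  shows "finite ((orbit S x k) ` (UNIV \<rightarrow> I))"
proof (induction k)
  case (Suc k)
  have "orbit S x (Suc k) ` (UNIV \<rightarrow> I) \<subseteq> (\<Union>i\<in>I. S i ` orbit S x k ` (UNIV \<rightarrow> I))"
    by auto
  then show ?case
    using Suc assms by (meson finite_UN finite_imageI finite_subset)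
qed (simp add: finite_subset[of _ "{x}"] image_subset_iff)

section \<open>Independence and averaging over the random indices\<close>

context prob_space
begin

text \<open>The \<open>card I\<close> equal probabilities already add up to 1, so natural numbers
  outside \<open>I\<close> are drawn with probability 0.\<close>

lemma AE_uniform_index:
  fixes X :: "'a \<Rightarrow> nat"
  assumes X: "random_variable (count_space UNIV) X" and I: "finite I" "I \<noteq> {}"
    and unif: "\<And>i. i \<in> I \<Longrightarrow> prob {\<omega> \<in> space M. X \<omega> = i} = 1 / card I"
  shows "AE \<omega> in M. X \<omega> \<in> I"
proof -
  note X[measurable]
  have "prob (\<Union>i\<in>I. {\<omega> \<in> space M. X \<omega> = i}) = (\<Sum>i\<in>I. prob {\<omega> \<in> space M. X \<omega> = i})"
    using I by (intro finite_measure_finite_Union) (auto simp: disjoint_family_on_def)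
  also have "\<dots> = 1"
    using I unif by simp
  also have "(\<Union>i\<in>I. {\<omega> \<in> space M. X \<omega> = i}) = {\<omega> \<in> space M. X \<omega> \<in> I}"
    by auto
  finally show ?thesis
    by (subst (asm) prob_Collect_eq_1) auto
qed

text \<open>Almost surely all draws lie in \<open>I\<close>, so the state takes finitely many values
  and any real function of it is bounded.\<close>

lemma integrable_orbit:
  fixes \<phi> :: "'b \<Rightarrow> real"
  assumes meas: "\<And>j. random_variable (count_space UNIV) (idx j)"
    and I: "finite I" "I \<noteq> {}" and AE: "\<And>j. AE \<omega> in M. idx j \<omega> \<in> I"
  shows "integrable M (\<lambda>\<omega>. \<phi> (orbit S x k (\<lambda>j. idx j \<omega>)))"
proof -
  define F where "F = orbit S x k ` (UNIV \<rightarrow> I)"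
  have "finite F" by (simp add: F_def finite_orbits I)
  have "AE \<omega> in M. \<forall>j. idx j \<omega> \<in> I"
    using AE by (simp add: AE_all_countable)
  then have "AE \<omega> in M. norm (\<phi> (orbit S x k (\<lambda>j. idx j \<omega>))) \<le> (\<Sum>y\<in>F. \<bar>\<phi> y\<bar>)"
  proof eventually_elim
    case (elim \<omega>)
    then have "orbit S x k (\<lambda>j. idx j \<omega>) \<in> F"
      by (auto simp: F_def)
    then show ?case
      using member_le_sum[of _ F "\<lambda>y. \<bar>\<phi> y\<bar>"] \<open>finite F\<close> by simp
  qed
  moreover have "(\<lambda>\<omega>. \<phi> (orbit S x k (\<lambda>j. idx j \<omega>))) \<in> borel_measurable M"
    by (rule measurable_compose[OF measurable_orbit]) (use meas in auto)
  ultimately show ?thesis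
    by (rule integrable_const_bound)
qed

text \<open>The state after \<open>k\<close> steps reads only the draws
  \<open>0, ..., k - 1\<close>, a block disjoint from draw \<open>k\<close>.\<close>

lemma indep_var_orbit_index:
  fixes \<phi> :: "'b \<Rightarrow> real" and \<psi> :: "nat \<Rightarrow> real"
  assumes "indep_vars (\<lambda>_. count_space UNIV) idx UNIV"
  shows "indep_var borel (\<lambda>\<omega>. \<phi> (orbit S x k (\<lambda>j. idx j \<omega>))) borel (\<lambda>\<omega>. \<psi> (idx k \<omega>))"
proof -
  have "indep_var (PiM {..<k} (\<lambda>_. count_space UNIV)) (\<lambda>\<omega>. restrict (\<lambda>j. idx j \<omega>) {..<k})
      (PiM {k} (\<lambda>_. count_space UNIV)) (\<lambda>\<omega>. restrict (\<lambda>j. idx j \<omega>) {k})"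
    by (rule indep_var_restrict[OF assms]) auto
  moreover have "(\<lambda>a. \<phi> (orbit S x k a)) \<in> measurable (PiM {..<k} (\<lambda>_. count_space UNIV)) borel"
    by (rule measurable_compose[OF measurable_orbit]) auto
  moreover have "(\<lambda>a. \<psi> (a k)) \<in> measurable (PiM {k} (\<lambda>_. count_space UNIV)) borel"
    by (rule measurable_compose[OF measurable_component_singleton]) auto
  ultimately have "indep_var borel ((\<lambda>a. \<phi> (orbit S x k a)) \<circ> (\<lambda>\<omega>. restrict (\<lambda>j. idx j \<omega>) {..<k}))
      borel ((\<lambda>a. \<psi> (a k)) \<circ> (\<lambda>\<omega>. restrict (\<lambda>j. idx j \<omega>) {k}))"
    by (rule indep_var_compose)
  moreover have "orbit S x k (restrict (\<lambda>j. idx j \<omega>) {..<k}) = orbit S x k (\<lambda>j. idx j \<omega>)" for \<omega>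
    by (rule orbit_cong) simp
  ultimately show ?thesis by (simp add: comp_def)
qed

text \<open>Splitting by the value of draw \<open>k\<close> gives a sum of products of a function of
  the current state and an indicator of the draw. Independence factors each product, and every
  indicator has mean \<open>1 / card I\<close>; no conditional expectation is required.\<close>

lemma expectation_orbit_Suc:
  fixes \<phi> :: "'b \<Rightarrow> real"
  assumes indep: "indep_vars (\<lambda>_. count_space UNIV) idx UNIV"
    and I: "finite I" "I \<noteq> {}"
    and unif: "\<And>j i. i \<in> I \<Longrightarrow> prob {\<omega> \<in> space M. idx j \<omega> = i} = 1 / card I"
  shows "expectation (\<lambda>\<omega>. \<phi> (orbit S x (Suc k) (\<lambda>j. idx j \<omega>)))
    = (\<Sum>i\<in>I. expectation (\<lambda>\<omega>. \<phi> (S i (orbit S x k (\<lambda>j. idx j \<omega>))))) / card I"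
proof -
  let ?X = "\<lambda>\<omega>. orbit S x k (\<lambda>j. idx j \<omega>)"
  have meas: "random_variable (count_space UNIV) (idx j)" for j
    using indep by (auto simp: indep_vars_def)
  note meas[measurable]
  have AE: "AE \<omega> in M. idx j \<omega> \<in> I" for j
    using AE_uniform_index[OF meas I unif] .
  have int: "integrable M (\<lambda>\<omega>. \<psi> (?X \<omega>))" for \<psi> :: "'b \<Rightarrow> real"
    by (rule integrable_orbit[OF meas I AE])
  have ind_int: "integrable M (\<lambda>\<omega>. indicator {i} (idx k \<omega>) :: real)" for i
    by (rule integrable_const_bound[where B = 1])
      (auto intro: measurable_compose[where N = "count_space UNIV", OF meas])
  have ind: "indep_var borel (\<lambda>\<omega>. \<psi> (?X \<omega>)) borel (\<lambda>\<omega>. indicator {i} (idx k \<omega>) :: real)"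
    for \<psi> :: "'b \<Rightarrow> real" and i
    by (rule indep_var_orbit_index[OF indep])
  have prod: "expectation (\<lambda>\<omega>. \<psi> (?X \<omega>) * indicator {i} (idx k \<omega>)) = expectation (\<lambda>\<omega>. \<psi> (?X \<omega>)) / card I"
    if "i \<in> I" for \<psi> :: "'b \<Rightarrow> real" and i
  proof -
    have "expectation (\<lambda>\<omega>. indicator {i} (idx k \<omega>) :: real)
        = expectation (indicator {\<omega> \<in> space M. idx k \<omega> = i})"
      by (rule Bochner_Integration.integral_cong) (auto simp: indicator_def)
    also have "\<dots> = 1 / card I"
      using unif[OF that, of k] by simp
    finally show ?thesis
      by (subst indep_var_lebesgue_integral[OF ind[of \<psi>] int[of \<psi>] ind_int]) simp
  qed
  have "expectation (\<lambda>\<omega>. \<phi> (orbit S x (Suc k) (\<lambda>j. idx j \<omega>)))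
      = expectation (\<lambda>\<omega>. \<Sum>i\<in>I. \<phi> (S i (?X \<omega>)) * indicator {i} (idx k \<omega>))"
  proof (rule integral_cong_AE)
    \<comment> \<open>Only the summand with \<open>i = idx k \<omega>\<close> survives. Equality
      holds almost everywhere because it needs this index to lie in \<open>I\<close>.\<close>
    show "AE \<omega> in M. \<phi> (orbit S x (Suc k) (\<lambda>j. idx j \<omega>))
        = (\<Sum>i\<in>I. \<phi> (S i (?X \<omega>)) * indicator {i} (idx k \<omega>))"
      using AE[of k]
    proof eventually_elim
      case (elim \<omega>)
      then show ?case
        using I by (subst sum.remove[of I "idx k \<omega>"]) (auto intro!: sum.neutral simp: indicator_def)
    qed
    show "random_variable borel (\<lambda>\<omega>. \<phi> (orbit S x (Suc k) (\<lambda>j. idx j \<omega>)))"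
      by (rule measurable_compose[OF measurable_orbit]) auto
    show "random_variable borel (\<lambda>\<omega>. \<Sum>i\<in>I. \<phi> (S i (?X \<omega>)) * indicator {i} (idx k \<omega>))"
      using borel_measurable_integrable[OF int] borel_measurable_integrable[OF ind_int]
      by (intro borel_measurable_sum borel_measurable_times) auto
  qed
  also have "\<dots> = (\<Sum>i\<in>I. expectation (\<lambda>\<omega>. \<phi> (S i (?X \<omega>)) * indicator {i} (idx k \<omega>)))"
    by (rule Bochner_Integration.integral_sum)
      (rule indep_var_integrable[OF ind[of "\<phi> \<circ> S _", unfolded comp_def] int ind_int])
  also have "\<dots> = (\<Sum>i\<in>I. expectation (\<lambda>\<omega>. \<phi> (S i (?X \<omega>)))) / card I"
    by (simp add: prod[of i "\<lambda>v. \<phi> (S i v)" for i] sum_divide_distrib)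
  finally show ?thesis .
qed

end

text \<open>Positivity of \<open>\<delta> k\<close> is asserted under the contraction condition:
  with \<open>J = 1\<close> and three times the exact inverse as \<open>R\<close>, the error doubles
  and \<open>\<delta> k\<close> is negative. The upper bound asks for a nonzero next error: with
  \<open>J = 1\<close> and the exact inverse, a nonzero initial error is removed at once and
  \<open>\<delta> 0 = J\<close>.\<close>

theorem theorem2:
  fixes A :: "'a::{real_inner, complete_space} \<Rightarrow> 'a"
    and f u u0 :: 'a
    and J :: nat
    and V :: "nat \<Rightarrow> 'a set"
    and Q P AS R Rt :: "nat \<Rightarrow> 'a \<Rightarrow> 'a"
    and M :: "'w measure"
    and idx :: "nat \<Rightarrow> 'w \<Rightarrow> nat"
    and U e :: "nat \<Rightarrow> 'w \<Rightarrow> 'a"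
    and \<delta> :: "nat \<Rightarrow> real"
  assumes A: "spd_operator A"
    and u: "A u = f"
    and J: "J \<ge> 1"
    and V: "space_decomposition J V"
    and Q: "\<And>i. i \<in> {1..J} \<Longrightarrow> is_projection (V i) (Q i)"
    and P: "\<And>i. i \<in> {1..J} \<Longrightarrow> is_A_projection A (V i) (P i)"
    and AS: "\<And>i. i \<in> {1..J} \<Longrightarrow> is_restriction A (V i) (AS i)"
    and R: "\<And>i. i \<in> {1..J} \<Longrightarrow> nonsingular_linear_on (V i) (R i)"
    and Rt: "\<And>i. i \<in> {1..J} \<Longrightarrow> is_adjoint_on (V i) (R i) (Rt i)"
    and M: "prob_space M"
    and idx_indep: "prob_space.indep_vars M (\<lambda>_. count_space UNIV) idx UNIV"
    and idx_uniform:
      "\<And>k i. i \<in> {1..J} \<Longrightarrow> measure M {\<omega> \<in> space M. idx k \<omega> = i} = 1 / real J"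
    and U_0: "\<And>\<omega>. \<omega> \<in> space M \<Longrightarrow> U 0 \<omega> = u0"
    and U_Suc: "\<And>k \<omega>. \<omega> \<in> space M \<Longrightarrow>
      U (Suc k) \<omega> = U k \<omega> + R (idx k \<omega>) (Q (idx k \<omega>) (f - A (U k \<omega>)))"
    and e: "\<And>k \<omega>. \<omega> \<in> space M \<Longrightarrow> e k \<omega> = u - U k \<omega>"
    and \<delta>: "\<And>k. \<delta> k =
      (\<integral>\<omega>. A_inner A (B_parallel J Q AS R Rt (A (e k \<omega>))) (e k \<omega>) \<partial>M) /
      (\<integral>\<omega>. A_inner A (e k \<omega>) (e k \<omega>) \<partial>M)"
  shows
    "(\<forall>k.
        (\<integral>\<omega>. (A_norm A (u - U (Suc k) \<omega>))\<^sup>2 \<partial>M)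
          = (1 - \<delta> k / real J) * (\<integral>\<omega>. (A_norm A (u - U k \<omega>))\<^sup>2 \<partial>M) \<and>
        (1 - \<delta> k / real J) * (\<integral>\<omega>. (A_norm A (u - U k \<omega>))\<^sup>2 \<partial>M)
          = (\<Prod>l=0..k. 1 - \<delta> l / real J) * (A_norm A (u - u0))\<^sup>2) \<and>
     ((\<forall>i\<in>{1..J}. A_opnorm_on A (V i) (\<lambda>v. v - T_op A (Q i) (R i) v) < 1) \<longrightarrow>
        (\<forall>k.
           ((\<integral>\<omega>. (A_norm A (e k \<omega>))\<^sup>2 \<partial>M) \<noteq> 0 \<longrightarrow> \<delta> k > 0) \<and>
           ((\<integral>\<omega>. (A_norm A (e (Suc k) \<omega>))\<^sup>2 \<partial>M) \<noteq> 0 \<longrightarrow> \<delta> k < real J)))"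
proof -
  interpret prob_space M by (rule M)
  define S where "S i v = v - T_op A (Q i) (R i) v" for i v
  define X where "X k \<omega> = orbit S (u - u0) k (\<lambda>j. idx j \<omega>)" for k \<omega>
  define b where "b v = A_inner A (B_parallel J Q AS R Rt (A v)) v" for v
  define \<phi> where "\<phi> v = A_inner A v v" for v
  have sub: "subspace (V i)" if "i \<in> {1..J}" for i
    using V that by (simp add: space_decomposition_def)
  \<comment> \<open>The hypotheses constrain the iterates on \<open>space M\<close> only, which is
    all that the integrals see.\<close>
  have eX: "e k \<omega> = X k \<omega>" if "\<omega> \<in> space M" for k \<omega>
  proof (induction k)
    case 0
    then show ?case using e U_0 that by (simp add: X_def)
  next
    case (Suc k)
    have "e (Suc k) \<omega> = e k \<omega> - R (idx k \<omega>) (Q (idx k \<omega>) (A (e k \<omega>)))"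
      using that e U_Suc linear_diff[OF spd_operatorD(1)[OF A]] by (simp add: u)
    then show ?case using Suc by (simp add: X_def S_def T_op_def)
  qed
  have err: "(\<integral>\<omega>. (A_norm A (u - U k \<omega>))\<^sup>2 \<partial>M) = expectation (\<lambda>\<omega>. \<phi> (X k \<omega>))"
    and err': "(\<integral>\<omega>. (A_norm A (e k \<omega>))\<^sup>2 \<partial>M) = expectation (\<lambda>\<omega>. \<phi> (X k \<omega>))" for k
    using e[of _ k] eX[of _ k] A_norm_power2[OF A]
    by (auto intro!: Bochner_Integration.integral_cong simp: \<phi>_def)
  have \<delta>X: "\<delta> k = expectation (\<lambda>\<omega>. b (X k \<omega>)) / expectation (\<lambda>\<omega>. \<phi> (X k \<omega>))" for k
    unfolding \<delta> b_def \<phi>_def using eX[of _ k]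
    by (auto intro!: arg_cong2[where f = "(/)"] Bochner_Integration.integral_cong)
  have meas: "random_variable (count_space UNIV) (idx j)" for j
    using idx_indep by (auto simp: indep_vars_def)
  have unif: "prob {\<omega> \<in> space M. idx j \<omega> = i} = 1 / card {1..J}" if "i \<in> {1..J}" for i j
    using idx_uniform[OF that] by simp
  have I: "finite {1..J}" "{1..J} \<noteq> {}"
    using J by auto
  have int: "integrable M (\<lambda>\<omega>. \<psi> (X k \<omega>))" for \<psi> :: "'a \<Rightarrow> real" and k
    unfolding X_def by (rule integrable_orbit[OF meas I AE_uniform_index[OF meas I unif]])
  have step: "(\<Sum>i\<in>{1..J}. \<phi> (S i v)) = real J * \<phi> v - b v" for v
  proof -
    have "\<phi> (S i v) = \<phi> v - A_inner A (R_bar (AS i) (R i) (Rt i) (Q i (A v))) v"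
      if "i \<in> {1..J}" for i
      unfolding \<phi>_def S_def by (rule A_inner_T_op_diff[OF A sub Q AS R Rt]) (use that in auto)
    then show ?thesis
      by (simp add: b_def A_inner_B_parallel[OF A] sum_subtractf)
  qed
  have \<phi>_nonneg: "\<phi> v \<ge> 0" for v
    by (simp add: \<phi>_def A_inner_self_nonneg[OF A])
  have \<phi>_0: "\<phi> v = 0 \<Longrightarrow> v = 0" for v
    by (simp add: \<phi>_def A_inner_self_eq_0_iff[OF A])
  have rec: "expectation (\<lambda>\<omega>. \<phi> (X (Suc k) \<omega>))
      = expectation (\<lambda>\<omega>. \<phi> (X k \<omega>)) - expectation (\<lambda>\<omega>. b (X k \<omega>)) / J" for k
  proof -
    have "expectation (\<lambda>\<omega>. \<phi> (X (Suc k) \<omega>)) = (\<Sum>i\<in>{1..J}. expectation (\<lambda>\<omega>. \<phi> (S i (X k \<omega>)))) / J"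
      using expectation_orbit_Suc[OF idx_indep I unif] by (simp add: X_def)
    also have "\<dots> = expectation (\<lambda>\<omega>. \<Sum>i\<in>{1..J}. \<phi> (S i (X k \<omega>))) / J"
      by (subst Bochner_Integration.integral_sum) (auto intro: int)
    also have "\<dots> = (J * expectation (\<lambda>\<omega>. \<phi> (X k \<omega>)) - expectation (\<lambda>\<omega>. b (X k \<omega>))) / J"
      unfolding step using int by simp
    finally show ?thesis
      using J by (simp add: diff_divide_distrib)
  qed
  \<comment> \<open>Division by zero gives \<open>\<delta> k = 0\<close> here, so the decay identity
    survives only if the numerator vanishes too. It does, since the error is then zero almost
    surely.\<close>
  have zero: "expectation (\<lambda>\<omega>. b (X k \<omega>)) = 0" if "expectation (\<lambda>\<omega>. \<phi> (X k \<omega>)) = 0" for k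
  proof -
    have "AE \<omega> in M. \<phi> (X k \<omega>) = 0"
      using integral_nonneg_eq_0_iff_AE[OF int] \<phi>_nonneg that by simp
    then have "AE \<omega> in M. b (X k \<omega>) = 0"
      by eventually_elim (auto dest: \<phi>_0 simp: b_def A_inner_def)
    then show ?thesis
      by (rule integral_eq_zero_AE)
  qed
  have decay: "expectation (\<lambda>\<omega>. \<phi> (X (Suc k) \<omega>)) = (1 - \<delta> k / J) * expectation (\<lambda>\<omega>. \<phi> (X k \<omega>))" for k
    using rec[of k] zero[of k] by (cases "expectation (\<lambda>\<omega>. \<phi> (X k \<omega>)) = 0") (auto simp: \<delta>X field_simps)
  have init: "expectation (\<lambda>\<omega>. \<phi> (X 0 \<omega>)) = (A_norm A (u - u0))\<^sup>2"
    using A_norm_power2[OF A] by (simp add: X_def \<phi>_def prob_space)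
  have prod: "expectation (\<lambda>\<omega>. \<phi> (X (Suc k) \<omega>)) = (\<Prod>l=0..k. 1 - \<delta> l / real J) * (A_norm A (u - u0))\<^sup>2" for k
  proof (induction k)
    case 0
    then show ?case using decay[of 0] by (simp add: init)
  next
    case (Suc k)
    then show ?case using decay[of "Suc k"] by simp
  qed
  have pos: "\<delta> k > 0"
    if contr: "\<forall>i\<in>{1..J}. A_opnorm_on A (V i) (\<lambda>v. v - T_op A (Q i) (R i) v) < 1"
      and nz: "expectation (\<lambda>\<omega>. \<phi> (X k \<omega>)) \<noteq> 0" for k
  proof -
    \<comment> \<open>All summands are nonnegative, and one with \<open>P i v \<noteq> 0\<close> is
      strictly positive.\<close>
    have b_pos: "b v > 0" if "v \<noteq> 0" for v
    proof -
      let ?r = "\<lambda>i. A_inner A (R_bar (AS i) (R i) (Rt i) (Q i (A v))) v"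
      have r_pos: "?r i > 0" if "i \<in> {1..J}" "P i v \<noteq> 0" for i
        using R_bar_form_pos[OF A sub Q P AS R Rt] contr that by blast
      have "?r i \<ge> 0" if "i \<in> {1..J}" for i
        using r_pos[OF that] R_bar_form_eq_0[OF A sub Q P AS R Rt] that
        by (cases "P i v = 0") fastforce+
      moreover obtain i where "i \<in> {1..J}" "P i v \<noteq> 0"
        using A_projections_separate[OF A V P \<open>v \<noteq> 0\<close>] by blast
      ultimately show ?thesis
        using r_pos unfolding b_def A_inner_B_parallel[OF A]
        by (intro sum_pos2[of _ i]) auto
    qed
    have b_nonneg: "b v \<ge> 0" for v
      using b_pos[of v] by (cases "v = 0") (auto simp: b_def A_inner_def)
    \<comment> \<open>A nonnegative function with zero mean vanishes almost surely; by
      \<open>b_pos\<close> the error would vanish with it, against \<open>nz\<close>.\<close>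
    have "expectation (\<lambda>\<omega>. b (X k \<omega>)) \<noteq> 0"
    proof
      assume "expectation (\<lambda>\<omega>. b (X k \<omega>)) = 0"
      then have "AE \<omega> in M. b (X k \<omega>) = 0"
        using integral_nonneg_eq_0_iff_AE[OF int] b_nonneg by simp
      then have "AE \<omega> in M. \<phi> (X k \<omega>) = 0"
        by eventually_elim (metis b_pos less_irrefl \<phi>_def A_inner_self_eq_0_iff[OF A])
      then show False
        using nz by (simp add: integral_eq_zero_AE)
    qed
    then have "expectation (\<lambda>\<omega>. b (X k \<omega>)) > 0"
      using b_nonneg by (simp add: order_less_le Bochner_Integration.integral_nonneg)
    moreover have "expectation (\<lambda>\<omega>. \<phi> (X k \<omega>)) > 0"
      using nz \<phi>_nonneg by (simp add: order_less_le Bochner_Integration.integral_nonneg)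
    ultimately show ?thesis by (simp add: \<delta>X)
  qed
  have less: "\<delta> k < real J" if "expectation (\<lambda>\<omega>. \<phi> (X (Suc k) \<omega>)) \<noteq> 0" for k
  proof -
    have "expectation (\<lambda>\<omega>. \<phi> (X (Suc k) \<omega>)) > 0"
      using that \<phi>_nonneg by (simp add: order_less_le Bochner_Integration.integral_nonneg)
    moreover have "expectation (\<lambda>\<omega>. \<phi> (X k \<omega>)) \<ge> 0"
      using \<phi>_nonneg by (simp add: Bochner_Integration.integral_nonneg)
    \<comment> \<open>A positive product whose second factor is nonnegative has a positive first
      factor.\<close>
    ultimately have "1 - \<delta> k / J > 0"
      using decay[of k] by (simp add: zero_less_mult_iff)
    then show ?thesis using J by (simp add: field_simps)
  qed
  show ?thesis
    unfolding err err' using decay prod pos less by simp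
qed

end
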